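(* Let $p$ be a point of a complex manifold and let $f_1,\dots,f_m\in\mathcal{O}_p$ be non-constant germs of holomorphic polynomials at $p$ such that $f_1(p)=\dots=f_m(p)=0$. Assume $\alpha<0$. For non-zero real numbers $a_1,\dots,a_m$, there do not exist germs of holomorphic functions $g_1,\dots,g_n\in\mathcal{O}_p$ and non-zero real numbers $b_1,\dots,b_n$ such that $$\Bigl(1+\sum_{i=1}^m a_i|f_i|^2\Bigr)^{\alpha}=\sum_{j=1}^n b_j|g_j|^2$$ near $p$.
   Context: $\mathcal{O}_p$ denotes the local ring of germs of holomorphic functions at $p$. "Germ of a holomorphic polynomial" means a germ that is a polynomial in some fixed system of local holomorphic coordinates near $p$.
   Formalization: It is additionally assumed that the sum of a_i|f_i|^2 is not identically zero near p; without this the claim fails, e.g. f_1 = f_2 = z, a_1 = 1, a_2 = -1, where the left side is 1 = |1|^2. *)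

theory Defs
  imports "HOL-Analysis.Analysis"
begin

(* Holomorphy in several variables: real Frechet differentiability with a complex-linear
   derivative. Only used for open S. *)
definition holomorphic_several_on :: "(complex^'n \<Rightarrow> complex) \<Rightarrow> (complex^'n) set \<Rightarrow> bool"
  where "holomorphic_several_on F S \<longleftrightarrow>
    (\<forall>z\<in>S. \<exists>D. (F has_derivative D) (at z) \<and> (\<forall>c v. D (c *s v) = c * D v))"

definition polynomial_several :: "(complex^'n \<Rightarrow> complex) \<Rightarrow> bool"
  where "polynomial_several F \<longleftrightarrow>
    (\<exists>(E :: ('n \<Rightarrow> nat) set) c. finite E \<and>
      (\<forall>z. F z = (\<Sum>e\<in>E. c e * (\<Prod>k\<in>UNIV. (z $ k) ^ e k))))"

(* A chart is a pair (U, \<phi>); the values of \<phi> outside U are irrelevant. *)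
type_synonym ('a, 'n) cchart = "'a set \<times> ('a \<Rightarrow> complex^'n)"

definition is_cchart :: "('a::topological_space, 'n::finite) cchart \<Rightarrow> bool"
  where "is_cchart = (\<lambda>(U, \<phi>). open U \<and> open (\<phi> ` U) \<and>
    homeomorphism U (\<phi> ` U) \<phi> (inv_into U \<phi>))"

definition holomorphic_transition :: "('a, 'n::finite) cchart \<Rightarrow> ('a, 'n) cchart \<Rightarrow> bool"
  where "holomorphic_transition = (\<lambda>(U, \<phi>) (V, \<psi>).
    \<forall>k. holomorphic_several_on (\<lambda>z. \<psi> (inv_into U \<phi> z) $ k) (\<phi> ` (U \<inter> V)))"

definition compatible :: "('a, 'n::finite) cchart \<Rightarrow> ('a, 'n) cchart \<Rightarrow> bool"
  where "compatible C C' \<longleftrightarrow> holomorphic_transition C C' \<and> holomorphic_transition C' C"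

(* The manifold is the open set covered by the chart domains, with the topology inherited from
   the ambient type; it is all of the type if the charts cover it. Its dimension is CARD('n). *)
definition manifold_carrier :: "('a, 'n) cchart set \<Rightarrow> 'a set"
  where "manifold_carrier A = (\<Union>(U, \<phi>)\<in>A. U)"

definition complex_manifold ::
    "('a::{t2_space, second_countable_topology}, 'n::finite) cchart set \<Rightarrow> bool"
  where "complex_manifold A \<longleftrightarrow> (\<forall>C\<in>A. is_cchart C) \<and> (\<forall>C\<in>A. \<forall>C'\<in>A. compatible C C')"

(* Charts of the maximal atlas generated by A whose domain contains p. *)
definition local_coordinates ::
    "('a::topological_space, 'n::finite) cchart set \<Rightarrow> 'a \<Rightarrow> ('a, 'n) cchart \<Rightarrow> bool"
  where "local_coordinates A p C \<longleftrightarrow> is_cchart C \<and> p \<in> fst C \<and> fst C \<subseteq> manifold_carrier A \<and>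
    (\<forall>C'\<in>A. compatible C C')"

(* Germs at p are handled through representatives: a function is only meaningful near p, and
   every property of germs below is invariant under changing it away from p. *)
definition holomorphic_germ ::
    "('a::topological_space, 'n::finite) cchart set \<Rightarrow> 'a \<Rightarrow> ('a \<Rightarrow> complex) \<Rightarrow> bool"
  where "holomorphic_germ A p f \<longleftrightarrow>
    (\<exists>W. open W \<and> p \<in> W \<and> W \<subseteq> manifold_carrier A \<and>
      (\<forall>(U, \<phi>)\<in>A. holomorphic_several_on (\<lambda>z. f (inv_into U \<phi> z)) (\<phi> ` (U \<inter> W))))"

definition constant_germ :: "'a::topological_space \<Rightarrow> ('a \<Rightarrow> complex) \<Rightarrow> bool"
  where "constant_germ p f \<longleftrightarrow> (\<exists>c. \<forall>\<^sub>F q in nhds p. f q = c)"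

definition polynomial_germ ::
    "('a::topological_space, 'n::finite) cchart \<Rightarrow> 'a \<Rightarrow> ('a \<Rightarrow> complex) \<Rightarrow> bool"
  where "polynomial_germ C p f \<longleftrightarrow>
    (\<exists>F. polynomial_several F \<and> (\<forall>\<^sub>F q in nhds p. f q = F (snd C q)))"

(* The combination \<Sum>i a_i |f_i|^2, as a germ at p. Its not being the zero germ has to be assumed:
   for f_1 = f_2 and a_1 = - a_2 it vanishes, and then (1 + 0) powr \<alpha> = 1 = |1|^2 is a finite sum
   of the excluded kind. It is automatic when the f_i are linearly independent over the complex
   numbers, and when all a_i have the same sign. *)
definition zero_hermitian_germ ::
    "'a::topological_space \<Rightarrow> nat \<Rightarrow> (nat \<Rightarrow> real) \<Rightarrow> (nat \<Rightarrow> 'a \<Rightarrow> complex) \<Rightarrow> bool"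
  where "zero_hermitian_germ p m a f \<longleftrightarrow>
    (\<forall>\<^sub>F q in nhds p. (\<Sum>i=1..m. a i * (cmod (f i q))\<^sup>2) = 0)"

end

theory Submission
  imports Defs "HOL-Complex_Analysis.Complex_Analysis"
    "HOL-Computational_Algebra.Fundamental_Theorem_Algebra"
begin

text \<open>
  Write \<open>H = \<Sum>i a i |f i|\<^sup>2\<close>. If \<open>(1 + H) powr \<alpha>\<close> were a finite sum of terms \<open>b j |g j|\<^sup>2\<close>, then its
  polarization, a function of two independent variables, would have finite rank. The rank is
  infinite because negative powers of polynomials with different zeros are linearly independent.

  The problem is first restricted to a complex line through \<open>p\<close>, in the coordinates \<open>C\<close>, on which
  \<open>H\<close> does not vanish identically; such a line exists because \<open>H\<close> is not the zero germ. On it the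
  \<open>f i\<close> are polynomials in one variable \<open>t\<close> with \<open>f i 0 = 0\<close>. The polynomial
  \<open>Q w z = 1 + \<Sum>i a i (f i z) cnj (f i (cnj w))\<close>, also polynomial in \<open>w\<close>, extends \<open>1 + H\<close> from the
  antidiagonal \<open>w = cnj z\<close>, a totally real set, so that
  \<open>Q w z powr \<alpha> = \<Sum>j b j (g j z) cnj (g j (cnj w))\<close> holds for all small \<open>z\<close> and \<open>w\<close> (lemma
  \<open>polarization\<close>). Any \<open>n + 1\<close> of the functions \<open>z \<mapsto> Q w z powr \<alpha>\<close> are therefore linearly
  dependent near 0.

  For all but finitely many \<open>w\<close> the polynomial \<open>Q w\<close> is not constant, hence has zeros. No point \<open>z\<close>
  is a zero of infinitely many \<open>Q w\<close>, because \<open>Q 0 z = 1\<close>: the zeros move with \<open>w\<close>. So there are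
  \<open>n + 1\<close> small parameters \<open>w\<close> whose polynomials have zeros but share none (lemma
  \<open>parameters_without_common_zeros\<close>). The powers for these parameters are linearly independent
  (lemma \<open>negative_powers_linearly_independent\<close>): a linear relation would continue analytically to
  the nearest zero of the polynomials in it, where exactly one term blows up, since \<open>\<alpha> < 0\<close>.
\<close>

section \<open>Linear independence of negative powers of polynomials\<close>

lemma nontrivial_linear_relation:
  fixes M :: "'j \<Rightarrow> 'k \<Rightarrow> 'c::field"
  assumes "finite J" "finite K" "card J < card K"
  shows "\<exists>c. (\<exists>k\<in>K. c k \<noteq> 0) \<and> (\<forall>j\<in>J. (\<Sum>k\<in>K. c k * M j k) = 0)"
  using assms
proof (induction J arbitrary: K M rule: finite_induct)
  case empty
  then have "K \<noteq> {}" by auto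
  then show ?case by (intro exI[of _ "\<lambda>_. 1"]) auto
next
  case (insert j J)
  show ?case
  proof (cases "\<forall>k\<in>K. M j k = 0")
    case True
    obtain c where "\<exists>k\<in>K. c k \<noteq> 0" "\<forall>j\<in>J. (\<Sum>k\<in>K. c k * M j k) = 0"
      using insert.IH[of K M] insert.prems insert.hyps by auto
    with True show ?thesis by (intro exI[of _ c]) auto
  next
    case False
    then obtain k0 where k0: "k0 \<in> K" "M j k0 \<noteq> 0" by auto
    define K' where "K' = K - {k0}"
    have K': "finite K'" "k0 \<notin> K'" "K = insert k0 K'"
      using insert.prems k0 by (auto simp: K'_def)
    then have card: "card J < card K'" using insert by simp
    obtain c where c: "\<exists>k\<in>K'. c k \<noteq> 0"
        "\<forall>i\<in>J. (\<Sum>k\<in>K'. c k * (M i k - M i k0 / M j k0 * M j k)) = 0"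
      using insert.IH[of K' "\<lambda>i k. M i k - M i k0 / M j k0 * M j k"] K' card by auto
    define e where "e = - (\<Sum>k\<in>K'. c k * M j k) / M j k0"
    define c' where "c' = c(k0 := e)"
    have split: "(\<Sum>k\<in>K. c' k * M i k) = e * M i k0 + (\<Sum>k\<in>K'. c k * M i k)" for i
    proof -
      have "(\<Sum>k\<in>K'. c' k * M i k) = (\<Sum>k\<in>K'. c k * M i k)"
        using K' by (intro sum.cong) (auto simp: c'_def)
      then show ?thesis using K' by (simp add: c'_def)
    qed
    have "(\<Sum>k\<in>K. c' k * M i k) = 0" if "i \<in> insert j J" for i
    proof (cases "i = j")
      case True
      then show ?thesis using k0 by (simp add: split e_def)
    next
      case False
      with that c have "0 = (\<Sum>k\<in>K'. c k * (M i k - M i k0 / M j k0 * M j k))" by simp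
      also have "\<dots> = (\<Sum>k\<in>K'. c k * M i k - M i k0 / M j k0 * (c k * M j k))"
        by (intro sum.cong) (auto simp: algebra_simps)
      also have "\<dots> = (\<Sum>k\<in>K'. c k * M i k) - M i k0 / M j k0 * (\<Sum>k\<in>K'. c k * M j k)"
        by (simp only: sum_subtractf sum_distrib_left)
      finally show ?thesis by (simp add: split e_def)
    qed
    moreover have "\<exists>k\<in>K. c' k \<noteq> 0"
      using c K' by (auto simp: c'_def)
    ultimately show ?thesis by blast
  qed
qed

text \<open>A disc is simply connected, so a zero-free function has a holomorphic logarithm there. It
  is normalised to vanish at the centre, which makes the power built from it the principal one
  near the centre; the principal branch itself may jump further out.\<close>

lemma holomorphic_power_on_disc:
  assumes "f holomorphic_on ball 0 R" "R > 0" "f 0 = 1" "\<And>z. z \<in> ball 0 R \<Longrightarrow> f z \<noteq> 0"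
  obtains h where "h holomorphic_on ball 0 R"
    "\<And>z. z \<in> ball 0 R \<Longrightarrow> cmod (h z) = cmod (f z) powr \<alpha>"
    "\<forall>\<^sub>F z in nhds 0. h z = f z powr (of_real \<alpha>)"
proof -
  obtain L0 where L0: "L0 holomorphic_on ball 0 R" "\<And>z. z \<in> ball 0 R \<Longrightarrow> f z = exp (L0 z)"
    using contractible_imp_holomorphic_log[OF assms(1) convex_imp_contractible[OF convex_ball] assms(4)]
    by blast
  define L where "L = (\<lambda>z. L0 z - L0 0)"
  have hol: "L holomorphic_on ball 0 R"
    unfolding L_def by (intro holomorphic_intros L0)
  have "exp (L0 0) = 1" using L0(2)[of 0] assms by simp
  then have expL: "f z = exp (L z)" if "z \<in> ball 0 R" for z
    using L0(2)[OF that] by (simp add: L_def exp_diff)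
  show ?thesis
  proof (rule that[of "\<lambda>z. exp (of_real \<alpha> * L z)"])
    show "(\<lambda>z. exp (of_real \<alpha> * L z)) holomorphic_on ball 0 R"
      by (intro holomorphic_intros hol)
    show "cmod (exp (of_real \<alpha> * L z)) = cmod (f z) powr \<alpha>" if "z \<in> ball 0 R" for z
      using expL[OF that] by (simp add: powr_def)
    have "continuous_on (ball 0 R) L" by (rule holomorphic_on_imp_continuous_on[OF hol])
    then have "isCont L 0" using assms(2) by (simp add: continuous_on_eq_continuous_at)
    then have "(L \<longlongrightarrow> 0) (nhds 0)"
      unfolding continuous_at tendsto_at_iff_tendsto_nhds by (simp add: L_def)
    then have "\<forall>\<^sub>F z in nhds 0. dist (L z) 0 < pi"
      by (rule tendstoD) simp
    moreover have "\<forall>\<^sub>F z in nhds 0. z \<in> ball 0 R"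
      by (rule eventually_nhds_in_open) (use assms in auto)
    ultimately show "\<forall>\<^sub>F z in nhds 0. exp (of_real \<alpha> * L z) = f z powr (of_real \<alpha>)"
    proof eventually_elim
      case (elim z)
      have "\<bar>Im (L z)\<bar> < pi" using elim(1) abs_Im_le_cmod[of "L z"] by simp
      then have "Ln (exp (L z)) = L z" by (intro Ln_exp) auto
      then show ?case using expL[OF elim(2)] by (simp add: powr_def)
    qed
  qed
qed

text \<open>Among the zeros of the polynomials that occur in a linear relation, let \<open>\<zeta>\<close> be one of least
  modulus \<open>R\<close>. All the powers continue holomorphically to the disc of radius \<open>R\<close>, and the relation
  continues with them. At \<open>\<zeta>\<close> exactly one of the powers is unbounded, because the exponent is
  negative and the zeros are not shared; so the relation cannot hold near \<open>\<zeta>\<close>.\<close>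

lemma negative_powers_linearly_independent:
  fixes q :: "'k \<Rightarrow> complex poly" and \<alpha> :: real
  assumes K: "finite K" and \<alpha>: "\<alpha> < 0"
    and one: "\<And>k. k \<in> K \<Longrightarrow> poly (q k) 0 = 1"
    and root: "\<And>k. k \<in> K \<Longrightarrow> \<exists>z. poly (q k) z = 0"
    and disj: "\<And>k l z. k \<in> K \<Longrightarrow> l \<in> K \<Longrightarrow> poly (q k) z = 0 \<Longrightarrow> poly (q l) z = 0 \<Longrightarrow> k = l"
    and rel: "\<forall>\<^sub>F z in nhds 0. (\<Sum>k\<in>K. c k * (poly (q k) z powr (of_real \<alpha>))) = 0"
    and "k \<in> K"
  shows "c k = 0"
proof (rule ccontr)
  assume "c k \<noteq> 0"
  define K' where "K' = {k\<in>K. c k \<noteq> 0}"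
  have K': "finite K'" "k \<in> K'" "K' \<subseteq> K"
    using K \<open>k \<in> K\<close> \<open>c k \<noteq> 0\<close> by (auto simp: K'_def)
  define Z where "Z = (\<Union>k\<in>K'. {z. poly (q k) z = 0})"
  have "finite {z. poly (q k) z = 0}" if "k \<in> K'" for k
    using one[of k] K' that by (intro poly_roots_finite) auto
  then have "finite Z" unfolding Z_def using K' by blast
  moreover have "Z \<noteq> {}" using root[of k] K' \<open>k \<in> K\<close> by (auto simp: Z_def)
  ultimately obtain \<zeta> where \<zeta>: "\<zeta> \<in> Z" "\<And>z. z \<in> Z \<Longrightarrow> cmod \<zeta> \<le> cmod z"
    using arg_min_if_finite(1)[of Z cmod] arg_min_least[of Z _ cmod] by metis
  then obtain l where l: "l \<in> K'" "poly (q l) \<zeta> = 0" by (auto simp: Z_def)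
  define R where "R = cmod \<zeta>"
  have "\<zeta> \<noteq> 0" using one[of l] l K' by auto
  then have "R > 0" by (simp add: R_def)
  have nz: "poly (q k) z \<noteq> 0" if "k \<in> K'" "z \<in> ball 0 R" for k z
    using \<zeta>(2)[of z] that by (force simp: Z_def R_def)
  have "\<exists>h. h holomorphic_on ball 0 R \<and>
      (\<forall>z\<in>ball 0 R. cmod (h z) = cmod (poly (q k) z) powr \<alpha>) \<and>
      (\<forall>\<^sub>F z in nhds 0. h z = poly (q k) z powr (of_real \<alpha>))" if "k \<in> K'" for k
    by (rule holomorphic_power_on_disc[of "poly (q k)" R \<alpha>])
      (use nz that one K' \<open>R > 0\<close> in \<open>auto intro!: holomorphic_intros\<close>)
  then obtain h where h: "\<And>k. k \<in> K' \<Longrightarrow> h k holomorphic_on ball 0 R"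
      "\<And>k z. k \<in> K' \<Longrightarrow> z \<in> ball 0 R \<Longrightarrow> cmod (h k z) = cmod (poly (q k) z) powr \<alpha>"
      "\<And>k. k \<in> K' \<Longrightarrow> \<forall>\<^sub>F z in nhds 0. h k z = poly (q k) z powr (of_real \<alpha>)"
    by metis
  define S where "S = (\<lambda>z. \<Sum>k\<in>K'. c k * h k z)"
  have holS: "S holomorphic_on ball 0 R"
    unfolding S_def by (intro holomorphic_intros h)
  have "\<forall>\<^sub>F z in nhds 0. \<forall>k\<in>K'. h k z = poly (q k) z powr (of_real \<alpha>)"
    using K' h(3) by (intro eventually_ball_finite) auto
  with rel have "\<forall>\<^sub>F z in nhds 0. S z = 0"
  proof eventually_elim
    case (elim z)
    have "S z = (\<Sum>k\<in>K'. c k * (poly (q k) z powr (of_real \<alpha>)))"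
      unfolding S_def by (intro sum.cong) (use elim in auto)
    also have "\<dots> = (\<Sum>k\<in>K. c k * (poly (q k) z powr (of_real \<alpha>)))"
      by (rule sum.mono_neutral_left) (auto simp: K'_def K)
    finally show ?case using elim by simp
  qed
  then obtain T where T: "open T" "0 \<in> T" "\<And>z. z \<in> T \<Longrightarrow> S z = 0"
    unfolding eventually_nhds by blast
  have S0: "S z = 0" if "z \<in> ball 0 R" for z
    by (rule analytic_continuation_open[of "T \<inter> ball 0 R" "ball 0 R" S "\<lambda>_. 0"])
      (use T \<open>R > 0\<close> holS that in auto)

  \<comment> \<open>Multiplying the relation by the positive power \<open>u\<close> of the vanishing modulus turns the
    blow-up into a limit: all terms except the \<open>l\<close>-th tend to 0.\<close>
  define u where "u = (\<lambda>t::real. cmod (poly (q l) (of_real t * \<zeta>)) powr (-\<alpha>))"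
  define v where "v = (\<lambda>t::real. \<Sum>k\<in>K'-{l}. cmod (c k) * cmod (poly (q k) (of_real t * \<zeta>)) powr \<alpha>)"
  have lim: "((\<lambda>t::real. cmod (poly (q k) (of_real t * \<zeta>))) \<longlongrightarrow> cmod (poly (q k) \<zeta>)) (at_left 1)" for k
  proof -
    have "isCont (\<lambda>t::real. cmod (poly (q k) (of_real t * \<zeta>))) 1"
      by (intro continuous_intros)
    then have "((\<lambda>t::real. cmod (poly (q k) (of_real t * \<zeta>))) \<longlongrightarrow> cmod (poly (q k) (of_real 1 * \<zeta>))) (at 1)"
      unfolding isCont_def .
    then show ?thesis using tendsto_within_subset[of _ _ 1 UNIV "{..<1}"] by simp
  qed
  have "(u \<longlongrightarrow> cmod (poly (q l) \<zeta>) powr (-\<alpha>)) (at_left 1)"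
    unfolding u_def by (rule tendsto_powr'[OF lim tendsto_const]) (use \<alpha> in auto)
  then have u: "(u \<longlongrightarrow> 0) (at_left 1)" using l by simp
  have "(v \<longlongrightarrow> (\<Sum>k\<in>K'-{l}. cmod (c k) * cmod (poly (q k) \<zeta>) powr \<alpha>)) (at_left 1)"
    unfolding v_def
  proof (intro tendsto_sum tendsto_mult tendsto_const tendsto_powr'[OF lim tendsto_const])
    fix k assume "k \<in> K' - {l}"
    then have "poly (q k) \<zeta> \<noteq> 0" using disj[of k l \<zeta>] l K' by auto
    then show "cmod (poly (q k) \<zeta>) \<noteq> 0 \<or>
        0 < \<alpha> \<and> (\<forall>\<^sub>F t in at_left 1. 0 \<le> cmod (poly (q k) (of_real t * \<zeta>)))" by simp
  qed
  from tendsto_mult[OF u this] have uv: "((\<lambda>t. u t * v t) \<longlongrightarrow> 0) (at_left 1)" by simp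
  have "\<forall>\<^sub>F t in at_left (1::real). t \<in> {0<..<1}"
    by (rule eventually_at_left_real) simp
  then have "\<forall>\<^sub>F t in at_left 1. cmod (c l) \<le> u t * v t"
  proof eventually_elim
    case (elim t)
    define z where "z = of_real t * \<zeta>"
    have z: "z \<in> ball 0 R" using elim \<open>R > 0\<close> by (simp add: z_def norm_mult R_def)
    have "0 = c l * h l z + (\<Sum>k\<in>K'-{l}. c k * h k z)"
      using S0[OF z] K' l by (simp add: S_def sum.remove[OF K'(1) l(1)])
    then have "c l * h l z = - (\<Sum>k\<in>K'-{l}. c k * h k z)"
      by (simp add: eq_neg_iff_add_eq_0)
    then have "cmod (c l) * cmod (h l z) = cmod (\<Sum>k\<in>K'-{l}. c k * h k z)"
      by (metis norm_minus_cancel norm_mult)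
    also have "\<dots> \<le> (\<Sum>k\<in>K'-{l}. cmod (c k * h k z))" by (rule norm_sum)
    also have "\<dots> = v t"
      unfolding v_def by (intro sum.cong) (use h(2) z in \<open>auto simp: norm_mult z_def\<close>)
    finally have "cmod (c l) * cmod (poly (q l) z) powr \<alpha> \<le> v t"
      using h(2)[of l z] l z by simp
    then have "u t * (cmod (c l) * cmod (poly (q l) z) powr \<alpha>) \<le> u t * v t"
      by (rule mult_left_mono) (simp add: u_def)
    moreover have "u t * cmod (poly (q l) z) powr \<alpha> = 1"
      using nz[of l z] l z by (simp add: u_def z_def flip: powr_add)
    ultimately show ?case by (simp only: mult.left_commute[of "u t"] mult_1_right)
  qed
  then have "cmod (c l) \<le> 0"
    by (rule tendsto_lowerbound[OF uv]) simp
  then show False using l by (simp add: K'_def)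
qed

section \<open>Polarization\<close>

lemma holomorphic_zero_on_reals:
  assumes "h holomorphic_on ball 0 s" "\<And>x::real. \<bar>x\<bar> < s \<Longrightarrow> h (of_real x) = 0" "z \<in> ball 0 s"
  shows "h z = 0"
proof (rule analytic_continuation[of h "ball 0 s" "of_real ` {0<..<s}" 0])
  have "s > 0" using assms(3) by (auto intro: le_less_trans[OF norm_ge_zero])
  then show "0 \<in> ball (0::complex) s" by simp
  show "of_real ` {0<..<s} \<subseteq> ball (0::complex) s" by auto
  show "(0::complex) islimpt of_real ` {0<..<s}"
    unfolding islimpt_approachable
  proof (intro allI impI)
    fix e :: real assume "e > 0"
    then show "\<exists>x'\<in>of_real ` {0<..<s}. x' \<noteq> (0::complex) \<and> dist x' 0 < e"
      using \<open>s > 0\<close> by (intro bexI[OF _ imageI[of "min e s / 2"]]) (auto simp: min_def)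
  qed
qed (use assms in auto)

text \<open>Joint holomorphy of \<open>\<Phi>\<close> is expressed through one variable: \<open>\<Phi>\<close> is holomorphic along every
  holomorphic curve. In the coordinates \<open>z = x + \<i>y\<close>, \<open>w = x - \<i>y\<close> the antidiagonal \<open>w = cnj z\<close>
  is the set where \<open>x\<close> and \<open>y\<close> are real, so \<open>\<Phi>\<close> is shown to vanish for complex \<open>x\<close> first and then
  for complex \<open>y\<close>.\<close>

lemma polarization:
  fixes \<Phi> :: "complex \<Rightarrow> complex \<Rightarrow> complex"
  assumes hol: "\<And>u v S. u holomorphic_on S \<Longrightarrow> v holomorphic_on S \<Longrightarrow> u ` S \<subseteq> ball 0 r \<Longrightarrow>
      v ` S \<subseteq> ball 0 r \<Longrightarrow> (\<lambda>s. \<Phi> (u s) (v s)) holomorphic_on S"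
    and diag: "\<And>t. t \<in> ball 0 r \<Longrightarrow> \<Phi> t (cnj t) = 0"
    and z: "z \<in> ball 0 (r/2)" and w: "w \<in> ball 0 (r/2)"
  shows "\<Phi> z w = 0"
proof -
  have bound: "x + \<i> * y \<in> ball 0 r" "x - \<i> * y \<in> ball 0 r"
    if "x \<in> ball 0 (r/2)" "y \<in> ball 0 (r/2)" for x y :: complex
    using that norm_triangle_ineq[of x "\<i> * y"] norm_triangle_ineq4[of x "\<i> * y"]
    by (auto simp: norm_mult)
  have complex_x: "\<Phi> (x + \<i> * of_real y) (x - \<i> * of_real y) = 0"
    if "x \<in> ball 0 (r/2)" "\<bar>y\<bar> < r/2" for x y
  proof (rule holomorphic_zero_on_reals[OF _ _ that(1)])
    have y: "complex_of_real y \<in> ball 0 (r/2)" using that by simp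
    show "(\<lambda>x. \<Phi> (x + \<i> * of_real y) (x - \<i> * of_real y)) holomorphic_on ball 0 (r/2)"
      by (intro hol holomorphic_intros) (use bound[OF _ y] in auto)
    fix x :: real assume "\<bar>x\<bar> < r/2"
    then show "\<Phi> (of_real x + \<i> * of_real y) (of_real x - \<i> * of_real y) = 0"
      using diag[of "of_real x + \<i> * of_real y"] bound[of "of_real x", OF _ y] by simp
  qed
  have complex_y: "\<Phi> (x + \<i> * y) (x - \<i> * y) = 0"
    if "x \<in> ball 0 (r/2)" "y \<in> ball 0 (r/2)" for x y
  proof (rule holomorphic_zero_on_reals[OF _ _ that(2)])
    show "(\<lambda>y. \<Phi> (x + \<i> * y) (x - \<i> * y)) holomorphic_on ball 0 (r/2)"
      by (intro hol holomorphic_intros) (use bound[OF that(1)] in auto)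
  qed (use complex_x that in auto)
  have "(z + w) / 2 \<in> ball 0 (r/2)" "(z - w) / (2 * \<i>) \<in> ball 0 (r/2)"
    using z w norm_triangle_ineq[of z w] norm_triangle_ineq4[of z w]
    by (auto simp: norm_divide norm_mult)
  from complex_y[OF this] show ?thesis by (simp add: field_simps)
qed

section \<open>The theorem on a complex line\<close>

text \<open>If \<open>Q w\<close> vanishes at \<open>z\<close>, then only finitely many \<open>w'\<close> make \<open>Q w'\<close> vanish at \<open>z\<close>, since
  \<open>poly (Q w') z\<close> is a polynomial in \<open>w'\<close> with value 1 at 0. So parameters whose polynomials
  share no zeros can be chosen one after the other.\<close>

lemma parameters_without_common_zeros:
  fixes Q P :: "complex \<Rightarrow> complex poly"
  assumes QP: "\<And>z w. poly (Q w) z = poly (P z) w"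
    and Q0: "\<And>w. poly (Q w) 0 = 1" and P0: "\<And>z. poly (P z) 0 = 1"
    and "finite B" "\<delta> > 0"
  shows "\<exists>W. finite W \<and> card W = N \<and> W \<subseteq> ball 0 \<delta> - B \<and>
    (\<forall>w\<in>W. \<forall>w'\<in>W. \<forall>z. poly (Q w) z = 0 \<longrightarrow> poly (Q w') z = 0 \<longrightarrow> w = w')"
proof (induction N)
  case 0
  then show ?case by (intro exI[of _ "{}"]) auto
next
  case (Suc N)
  then obtain W where W: "finite W" "card W = N" "W \<subseteq> ball 0 \<delta> - B"
    "\<forall>w\<in>W. \<forall>w'\<in>W. \<forall>z. poly (Q w) z = 0 \<longrightarrow> poly (Q w') z = 0 \<longrightarrow> w = w'" by blast
  define B' where "B' = B \<union> W \<union> (\<Union>w\<in>W. \<Union>z\<in>{z. poly (Q w) z = 0}. {w'. poly (P z) w' = 0})"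
  have "Q w \<noteq> 0" for w using Q0[of w] by auto
  moreover have "P z \<noteq> 0" for z using P0[of z] by auto
  ultimately have "finite B'"
    unfolding B'_def using W(1) \<open>finite B\<close> by (auto intro!: poly_roots_finite)
  moreover have "infinite (ball (0::complex) \<delta>)"
    using \<open>\<delta> > 0\<close> uncountable_ball[of \<delta> "0::complex"] countable_finite by blast
  ultimately have "infinite (ball 0 \<delta> - B')" by (rule Diff_infinite_finite)
  then obtain w where w: "w \<in> ball 0 \<delta> - B'" by (metis finite.emptyI ex_in_conv)
  then have "poly (Q w) z \<noteq> 0" if "poly (Q w') z = 0" "w' \<in> W" for w' z
    using that by (auto simp: B'_def QP)
  then show ?case
    using W w by (intro exI[of _ "insert w W"]) (auto simp: B'_def)
qed

text \<open>Polarization on a small disc expresses every power \<open>z \<mapsto> poly (Q w) z powr \<alpha>\<close> through the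
  \<open>card J\<close> functions \<open>g j\<close>, so \<open>card J + 1\<close> parameters \<open>w\<close> give a linear relation between the powers,
  which their independence forbids. The point \<open>t\<^sub>0\<close> may lie anywhere in the plane, because
  polynomials are determined by their germs at 0.\<close>

lemma hermitian_power_not_finite_rank_line:
  fixes F :: "'i \<Rightarrow> complex poly" and g :: "'j \<Rightarrow> complex \<Rightarrow> complex"
    and a :: "'i \<Rightarrow> real" and b :: "'j \<Rightarrow> real"
  assumes "finite I" "finite J" "r > 0" "\<alpha> < 0"
    and F0: "\<And>i. i \<in> I \<Longrightarrow> poly (F i) 0 = 0"
    and nonzero: "(\<Sum>i\<in>I. a i * (cmod (poly (F i) t\<^sub>0))\<^sup>2) \<noteq> 0"
    and holg: "\<And>j. j \<in> J \<Longrightarrow> g j holomorphic_on ball 0 r"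
    and eq: "\<And>t. t \<in> ball 0 r \<Longrightarrow>
      (1 + (\<Sum>i\<in>I. a i * (cmod (poly (F i) t))\<^sup>2)) powr \<alpha> = (\<Sum>j\<in>J. b j * (cmod (g j t))\<^sup>2)"
  shows False
proof -
  define Q where "Q = (\<lambda>w. 1 + (\<Sum>i\<in>I. smult (of_real (a i) * poly (map_poly cnj (F i)) w) (F i)))"
  define P where "P = (\<lambda>z. 1 + (\<Sum>i\<in>I. smult (of_real (a i) * poly (F i) z) (map_poly cnj (F i))))"
  have Q: "poly (Q w) z = 1 + (\<Sum>i\<in>I. of_real (a i) * poly (map_poly cnj (F i)) w * poly (F i) z)" for z w
    by (simp add: Q_def poly_sum)
  have QP: "poly (Q w) z = poly (P z) w" for z w
    unfolding Q by (simp add: P_def poly_sum mult_ac)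
  have Q0: "poly (Q w) 0 = 1" for w by (simp add: Q F0)
  have P0: "poly (P z) 0 = 1" for z by (simp add: Q F0 flip: QP)

  have diag: "poly (Q (cnj t)) t = of_real (1 + (\<Sum>i\<in>I. a i * (cmod (poly (F i) t))\<^sup>2))" for t
  proof -
    have "of_real (a i) * poly (map_poly cnj (F i)) (cnj t) * poly (F i) t
        = of_real (a i * (cmod (poly (F i) t))\<^sup>2)" for i
      unfolding poly_cnj[symmetric] of_real_mult complex_norm_square by (simp add: mult_ac)
    then have "poly (Q (cnj t)) t = 1 + (\<Sum>i\<in>I. of_real (a i * (cmod (poly (F i) t))\<^sup>2))"
      by (simp only: Q)
    then show ?thesis by simp
  qed
  \<comment> \<open>Near the origin \<open>Q w\<close> takes values in the right half-plane, where the principal power is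
    holomorphic.\<close>
  define \<rho> where "\<rho> = (\<lambda>p. Re (poly (Q (snd p)) (fst p)))"
  have "continuous_on UNIV \<rho>"
    unfolding \<rho>_def Q by (intro continuous_intros)
  then have "isCont \<rho> 0"
    using continuous_on_eq_continuous_at open_UNIV by blast
  then have "(\<rho> \<longlongrightarrow> \<rho> 0) (nhds 0)"
    unfolding continuous_at tendsto_at_iff_tendsto_nhds .
  moreover have "\<rho> 0 = 1" by (simp add: \<rho>_def Q0)
  ultimately have "\<forall>\<^sub>F p in nhds 0. 0 < \<rho> p"
    by (intro order_tendstoD) auto
  then obtain d where d: "d > 0" "\<And>p. dist p 0 < d \<Longrightarrow> 0 < \<rho> p"
    unfolding eventually_nhds_metric by blast
  define \<delta> where "\<delta> = min r (d/2)"
  have \<delta>: "\<delta> > 0" "\<delta> \<le> r" using d \<open>r > 0\<close> by (auto simp: \<delta>_def)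
  have Re_pos: "0 < Re (poly (Q w) z)" if "z \<in> ball 0 \<delta>" "w \<in> ball 0 \<delta>" for z w
  proof -
    have "norm (z, w) \<le> norm z + norm w" by (rule norm_Pair_le)
    also have "\<dots> < d" using that by (auto simp: \<delta>_def)
    finally show ?thesis using d(2)[of "(z, w)"] by (simp add: \<rho>_def dist_norm)
  qed

  define G where "G = (\<lambda>j w. cnj (g j (cnj w)))"
  have holG: "G j holomorphic_on ball 0 \<delta>" if "j \<in> J" for j
  proof -
    have "cnj ` ball 0 \<delta> \<subseteq> ball 0 r" using \<delta> by auto
    then have "(cnj \<circ> g j \<circ> cnj) holomorphic_on ball 0 \<delta>"
      using holomorphic_on_subset[OF holg[OF that]] by (intro holomorphic_on_compose_cnj_cnj) auto
    then show ?thesis by (simp add: G_def o_def)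
  qed
  define \<Phi> where "\<Phi> = (\<lambda>z w. poly (Q w) z powr (of_real \<alpha>) - (\<Sum>j\<in>J. of_real (b j) * g j z * G j w))"
  have \<Phi>0: "\<Phi> z w = 0" if "z \<in> ball 0 (\<delta>/2)" "w \<in> ball 0 (\<delta>/2)" for z w
  proof (rule polarization[OF _ _ that])
    fix u v and S :: "complex set"
    assume uv: "u holomorphic_on S" "v holomorphic_on S" "u ` S \<subseteq> ball 0 \<delta>" "v ` S \<subseteq> ball 0 \<delta>"
    have "(\<lambda>s. poly (Q (v s)) (u s)) holomorphic_on S"
      unfolding Q by (intro holomorphic_intros uv)
    then have "(\<lambda>s. poly (Q (v s)) (u s) powr (of_real \<alpha>)) holomorphic_on S"
    proof (rule holomorphic_on_powr[OF _ holomorphic_on_const])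
      fix s assume "s \<in> S"
      then have "0 < Re (poly (Q (v s)) (u s))" using uv by (intro Re_pos) auto
      then show "poly (Q (v s)) (u s) \<notin> \<real>\<^sub>\<le>\<^sub>0" by (auto simp: complex_nonpos_Reals_iff)
    qed
    moreover have "(\<lambda>s. g j (u s)) holomorphic_on S" if "j \<in> J" for j
      using holomorphic_on_compose_gen[OF uv(1) holg[OF that]] uv(3) subset_ball[OF \<delta>(2)]
      by (auto simp: o_def)
    moreover have "(\<lambda>s. G j (v s)) holomorphic_on S" if "j \<in> J" for j
      using holomorphic_on_compose_gen[OF uv(2) holG[OF that]] uv by (auto simp: o_def)
    ultimately show "(\<lambda>s. \<Phi> (u s) (v s)) holomorphic_on S"
      unfolding \<Phi>_def
      by (intro holomorphic_on_diff holomorphic_on_sum holomorphic_on_mult holomorphic_on_const)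
  next
    fix t :: complex assume t: "t \<in> ball 0 \<delta>"
    then have "0 < 1 + (\<Sum>i\<in>I. a i * (cmod (poly (F i) t))\<^sup>2)"
      using Re_pos[of t "cnj t"] by (simp only: diag Re_complex_of_real) simp
    then have "poly (Q (cnj t)) t powr (of_real \<alpha>)
        = of_real ((1 + (\<Sum>i\<in>I. a i * (cmod (poly (F i) t))\<^sup>2)) powr \<alpha>)"
      unfolding diag by (intro powr_of_real) simp
    also have "\<dots> = of_real (\<Sum>j\<in>J. b j * (cmod (g j t))\<^sup>2)"
      using eq t \<delta> by simp
    also have "\<dots> = (\<Sum>j\<in>J. of_real (b j) * g j t * G j (cnj t))"
      by (simp add: G_def mult.assoc complex_norm_square[symmetric])
    finally show "\<Phi> t (cnj t) = 0" by (simp add: \<Phi>_def)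
  qed

  \<comment> \<open>Outside the finite set \<open>B\<close> the polynomial \<open>Q w\<close> takes different values at 0 and \<open>t\<^sub>0\<close>, so it is
    not constant and has a zero.\<close>
  define B where "B = {w. poly (P t\<^sub>0 - 1) w = 0}"
  have "poly (P t\<^sub>0 - 1) (cnj t\<^sub>0) = of_real (\<Sum>i\<in>I. a i * (cmod (poly (F i) t\<^sub>0))\<^sup>2)"
    using diag[of t\<^sub>0] by (simp flip: QP)
  then have "poly (P t\<^sub>0 - 1) (cnj t\<^sub>0) \<noteq> 0"
    using nonzero by (simp only: of_real_eq_0_iff) simp
  then have "finite B" unfolding B_def by (intro poly_roots_finite) auto
  have root: "\<exists>z. poly (Q w) z = 0" if "w \<notin> B" for w
  proof -
    have "poly (Q w) t\<^sub>0 \<noteq> poly (Q w) 0" using that Q0[of w] by (simp add: B_def flip: QP)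
    then have "degree (Q w) \<noteq> 0" by (intro notI) (auto elim!: degree_eq_zeroE)
    then show ?thesis by (intro alg_closed_imp_poly_has_root) simp
  qed
  obtain W where W: "finite W" "card W = Suc (card J)" "W \<subseteq> ball 0 (\<delta>/2) - B"
      "\<forall>w\<in>W. \<forall>w'\<in>W. \<forall>z. poly (Q w) z = 0 \<longrightarrow> poly (Q w') z = 0 \<longrightarrow> w = w'"
    using parameters_without_common_zeros[OF QP Q0 P0 \<open>finite B\<close>, of "\<delta>/2" "Suc (card J)"] \<delta> by auto
  obtain c where c: "\<exists>w\<in>W. c w \<noteq> 0" "\<forall>j\<in>J. (\<Sum>w\<in>W. c w * G j w) = 0"
    using nontrivial_linear_relation[OF \<open>finite J\<close> W(1), of G] W(2) by auto
  have "\<forall>\<^sub>F z in nhds 0. z \<in> ball 0 (\<delta>/2)"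
    by (rule eventually_nhds_in_open) (use \<delta> in auto)
  then have rel: "\<forall>\<^sub>F z in nhds 0. (\<Sum>w\<in>W. c w * (poly (Q w) z powr (of_real \<alpha>))) = 0"
  proof eventually_elim
    case (elim z)
    have "(\<Sum>w\<in>W. c w * (poly (Q w) z powr (of_real \<alpha>)))
        = (\<Sum>w\<in>W. \<Sum>j\<in>J. of_real (b j) * g j z * (c w * G j w))"
    proof (intro sum.cong refl)
      fix w assume "w \<in> W"
      then have "poly (Q w) z powr (of_real \<alpha>) = (\<Sum>j\<in>J. of_real (b j) * g j z * G j w)"
        using \<Phi>0[OF elim, of w] W(3) by (auto simp: \<Phi>_def)
      then show "c w * (poly (Q w) z powr (of_real \<alpha>))
          = (\<Sum>j\<in>J. of_real (b j) * g j z * (c w * G j w))"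
        by (simp add: sum_distrib_left mult_ac)
    qed
    also have "\<dots> = (\<Sum>j\<in>J. of_real (b j) * g j z * (\<Sum>w\<in>W. c w * G j w))"
      by (subst sum.swap) (simp add: sum_distrib_left)
    finally show ?case using c(2) by simp
  qed
  have "c w = 0" if "w \<in> W" for w
  proof (rule negative_powers_linearly_independent[OF W(1) \<open>\<alpha> < 0\<close> Q0 _ _ rel that])
    show "\<exists>z. poly (Q w) z = 0" if "w \<in> W" for w
      using root W(3) that by blast
    show "w = w'" if "w \<in> W" "w' \<in> W" "poly (Q w) z = 0" "poly (Q w') z = 0" for w w' z
      using W(4) that by blast
  qed
  with c(1) show False by auto
qed

section \<open>Charts and complex lines\<close>

lemma chart_inverse_tendsto:
  assumes "is_cchart (U, \<phi>)" "p \<in> U"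
  shows "filterlim (inv_into U \<phi>) (nhds p) (nhds (\<phi> p))"
proof -
  have U: "open U" "open (\<phi> ` U)" "homeomorphism U (\<phi> ` U) \<phi> (inv_into U \<phi>)"
    using assms(1) by (auto simp: is_cchart_def)
  have "continuous_on (\<phi> ` U) (inv_into U \<phi>)" "inv_into U \<phi> (\<phi> p) = p"
    using U(3) assms(2) by (auto simp: homeomorphism_def)
  moreover have "\<phi> p \<in> \<phi> ` U" using assms(2) by simp
  ultimately have "isCont (inv_into U \<phi>) (\<phi> p)"
    using U(2) continuous_on_eq_continuous_at by blast
  then show ?thesis
    unfolding continuous_at tendsto_at_iff_tendsto_nhds using \<open>inv_into U \<phi> (\<phi> p) = p\<close> by simp
qed

lemma chart_tendsto:
  fixes \<phi> :: "'a::t2_space \<Rightarrow> complex^'n::finite"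
  assumes "is_cchart (U, \<phi>)" "p \<in> U"
  shows "filterlim \<phi> (nhds (\<phi> p)) (nhds p)"
proof -
  have "open U" "continuous_on U \<phi>"
    using assms(1) by (auto simp: is_cchart_def homeomorphism_def)
  then have "isCont \<phi> p" using assms(2) continuous_on_eq_continuous_at by blast
  then show ?thesis unfolding continuous_at tendsto_at_iff_tendsto_nhds .
qed

lemma has_derivative_vec_componentwise:
  fixes f :: "'x::real_normed_vector \<Rightarrow> 'y::euclidean_space^'n"
  assumes "\<And>k. ((\<lambda>x. f x $ k) has_derivative D k) (at x)"
  shows "(f has_derivative (\<lambda>h. \<chi> k. D k h)) (at x)"
proof (rule has_derivative_componentwise_within[THEN iffD2], rule ballI)
  fix i :: "'y^'n" assume "i \<in> Basis"
  then obtain k u where i: "i = axis k u" by (auto simp: Basis_vec_def)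
  show "((\<lambda>x. f x \<bullet> i) has_derivative (\<lambda>h. (\<chi> k. D k h) \<bullet> i)) (at x)"
    unfolding i inner_axis using has_derivative_inner_left[OF assms[of k], of u] by simp
qed

text \<open>A germ is holomorphic in the charts of the given atlas, while the coordinates \<open>C\<close> in which
  the \<open>f i\<close> are polynomials belong only to the maximal atlas. The transition map, composed by the
  chain rule, carries complex linear differentiability over to \<open>C\<close>.\<close>

lemma holomorphic_germ_in_local_coordinates:
  fixes g :: "'a::t2_space \<Rightarrow> complex" and \<phi> :: "'a \<Rightarrow> complex^'n::finite"
  assumes charts: "\<And>B. B \<in> A \<Longrightarrow> is_cchart B"
    and loc: "local_coordinates A p (U, \<phi>)" and g: "holomorphic_germ A p g"
  shows "\<forall>\<^sub>F z in nhds (\<phi> p). \<exists>D. ((\<lambda>z. g (inv_into U \<phi> z)) has_derivative D) (at z) \<and>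
    (\<forall>c v. D (c *s v) = c * D v)"
proof -
  have C: "is_cchart (U, \<phi>)" "p \<in> U" and comp: "\<And>B. B \<in> A \<Longrightarrow> compatible (U, \<phi>) B"
    using loc by (auto simp: local_coordinates_def)
  obtain W where W: "open W" "p \<in> W" "W \<subseteq> manifold_carrier A"
      "\<And>V \<psi>. (V, \<psi>) \<in> A \<Longrightarrow> holomorphic_several_on (\<lambda>z. g (inv_into V \<psi> z)) (\<psi> ` (V \<inter> W))"
    using g unfolding holomorphic_germ_def by fast
  obtain V \<psi> where V: "(V, \<psi>) \<in> A" "p \<in> V"
    using W(2,3) by (auto simp: manifold_carrier_def)
  have ch: "open U" "open (\<phi> ` U)" "open V" "inj_on \<psi> V"
    using C(1) charts[OF V(1)]
    by (auto simp: is_cchart_def homeomorphism_def intro: inj_on_inverseI)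
  have "\<forall>\<^sub>F x in nhds p. x \<in> U \<inter> V \<inter> W"
    by (rule eventually_nhds_in_open) (use ch W V C in auto)
  then have "\<forall>\<^sub>F z in nhds (\<phi> p). inv_into U \<phi> z \<in> U \<inter> V \<inter> W"
    using chart_inverse_tendsto[OF C] by (auto simp: filterlim_iff)
  then have "\<forall>\<^sub>F z in nhds (\<phi> p). \<forall>\<^sub>F z' in nhds z. inv_into U \<phi> z' \<in> U \<inter> V \<inter> W"
    by (simp add: eventually_eventually)
  moreover have "\<forall>\<^sub>F z in nhds (\<phi> p). z \<in> \<phi> ` U"
    by (rule eventually_nhds_in_open) (use ch C in auto)
  ultimately show ?thesis
  proof eventually_elim
    case (elim z)
    define x where "x = inv_into U \<phi> z"
    define \<tau> where "\<tau> = (\<lambda>z. \<psi> (inv_into U \<phi> z))"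
    have x: "x \<in> U \<inter> V \<inter> W"
      using eventually_nhds_x_imp_x[OF elim(1)] by (simp add: x_def)
    have "\<phi> x = z" using elim(2) by (simp add: x_def f_inv_into_f)
    then have z: "z \<in> \<phi> ` (U \<inter> V)" using x by auto
    have "holomorphic_several_on (\<lambda>z. \<tau> z $ k) (\<phi> ` (U \<inter> V))" for k
      using comp[OF V(1)] by (simp add: compatible_def holomorphic_transition_def \<tau>_def)
    then have "\<forall>k. \<exists>D. ((\<lambda>z. \<tau> z $ k) has_derivative D) (at z) \<and> (\<forall>c v. D (c *s v) = c * D v)"
      using z unfolding holomorphic_several_on_def by blast
    then obtain D where D: "\<And>k. ((\<lambda>z. \<tau> z $ k) has_derivative D k) (at z)"
        "\<And>k c v. D k (c *s v) = c * D k v" by metis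
    have \<tau>: "(\<tau> has_derivative (\<lambda>h. \<chi> k. D k h)) (at z)"
      by (rule has_derivative_vec_componentwise[OF D(1)])
    have "\<psi> x \<in> \<psi> ` (V \<inter> W)" using x by auto
    then obtain E where E: "((\<lambda>z. g (inv_into V \<psi> z)) has_derivative E) (at (\<psi> x))"
        "\<And>c v. E (c *s v) = c * E v"
      using W(4)[OF V(1)] unfolding holomorphic_several_on_def by blast
    have ev: "\<forall>\<^sub>F z' in nhds z. g (inv_into V \<psi> (\<tau> z')) = g (inv_into U \<phi> z')"
      using elim(1) by eventually_elim (simp add: \<tau>_def inv_into_f_f[OF ch(4)])
    have "((\<lambda>z. g (inv_into V \<psi> (\<tau> z))) has_derivative (\<lambda>h. E (\<chi> k. D k h))) (at z)"
      using has_derivative_compose[OF \<tau>, of "\<lambda>z. g (inv_into V \<psi> z)" E] E(1)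
      by (simp add: \<tau>_def x_def)
    moreover have "\<forall>\<^sub>F z' in at z. g (inv_into V \<psi> (\<tau> z')) = g (inv_into U \<phi> z')"
      using ev unfolding eventually_at_filter by (rule eventually_mono) simp
    ultimately have "((\<lambda>z. g (inv_into U \<phi> z)) has_derivative (\<lambda>h. E (\<chi> k. D k h))) (at z)"
      by (rule has_derivative_transform_eventually) (use eventually_nhds_x_imp_x[OF ev] in auto)
    moreover have "E (\<chi> k. D k (c *s v)) = c * E (\<chi> k. D k v)" for c v
    proof -
      have "(\<chi> k. D k (c *s v)) = c *s (\<chi> k. D k v)" by (simp add: vec_eq_iff D(2))
      then show ?thesis by (simp add: E(2))
    qed
    ultimately show ?case by (intro exI[of _ "\<lambda>h. E (\<chi> k. D k h)"]) blast
  qed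
qed

lemma norm_complex_smult: "norm (c *s v) = cmod c * norm (v :: complex^'n)"
  by (simp add: norm_vec_def norm_mult L2_set_right_distrib)

lemma holomorphic_on_complex_line:
  fixes G :: "complex^'n \<Rightarrow> complex"
  assumes "\<And>t. t \<in> S \<Longrightarrow>
    \<exists>D. (G has_derivative D) (at (z + t *s v)) \<and> (\<forall>c v. D (c *s v) = c * D v)"
  shows "(\<lambda>t. G (z + t *s v)) holomorphic_on S"
  unfolding holomorphic_on_def
proof
  fix t assume "t \<in> S"
  then obtain D where D: "(G has_derivative D) (at (z + t *s v))" "\<And>c v. D (c *s v) = c * D v"
    using assms by blast
  have "bounded_linear (\<lambda>t. t *s v)"
    by (intro linear_conv_bounded_linear[THEN iffD1] linearI) 
      (auto simp: vec_eq_iff algebra_simps)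
  then have "((\<lambda>t. z + t *s v) has_derivative (\<lambda>t. t *s v)) (at t)"
    using has_derivative_add[OF has_derivative_const bounded_linear_imp_has_derivative] by fastforce
  from has_derivative_compose[OF this D(1)]
  have "((\<lambda>t. G (z + t *s v)) has_field_derivative D v) (at t)"
    unfolding has_field_derivative_def D(2) mult.commute[of "D v"] .
  then show "(\<lambda>t. G (z + t *s v)) field_differentiable at t within S"
    using field_differentiable_at_within field_differentiable_def by blast
qed

lemma polynomial_several_on_complex_line:
  assumes "polynomial_several F"
  obtains q where "\<And>t. F (z + t *s v) = poly q t"
proof -
  obtain E c where F: "\<And>z. F z = (\<Sum>e\<in>E. c e * (\<Prod>k\<in>UNIV. (z $ k) ^ e k))"
    using assms unfolding polynomial_several_def by blast
  have "F (z + t *s v) = poly (\<Sum>e\<in>E. smult (c e) (\<Prod>k\<in>UNIV. [:z $ k, v $ k:] ^ e k)) t" for t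
    by (simp add: F poly_sum poly_prod)
  then show ?thesis using that by blast
qed

theorem corollary3p2:
  fixes A :: "('a::{t2_space, second_countable_topology}, 'n::finite) cchart set"
    and p :: 'a and C :: "('a, 'n) cchart"
    and f :: "nat \<Rightarrow> 'a \<Rightarrow> complex" and a :: "nat \<Rightarrow> real"
    and m :: nat and \<alpha> :: real
  assumes "complex_manifold A" and "p \<in> manifold_carrier A"
    and "local_coordinates A p C"
    and "m \<ge> 1"
    and "\<And>i. i \<in> {1..m} \<Longrightarrow> holomorphic_germ A p (f i)"
    and "\<And>i. i \<in> {1..m} \<Longrightarrow> polynomial_germ C p (f i)"
    and "\<And>i. i \<in> {1..m} \<Longrightarrow> \<not> constant_germ p (f i)"
    and "\<And>i. i \<in> {1..m} \<Longrightarrow> f i p = 0"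
    and "\<alpha> < 0"
    and "\<And>i. i \<in> {1..m} \<Longrightarrow> a i \<noteq> 0"
    and "\<not> zero_hermitian_germ p m a f"
  shows "\<not> (\<exists>(n::nat) (g :: nat \<Rightarrow> 'a \<Rightarrow> complex) (b :: nat \<Rightarrow> real).
      (\<forall>j\<in>{1..n}. holomorphic_germ A p (g j)) \<and> (\<forall>j\<in>{1..n}. b j \<noteq> 0) \<and>
      (\<forall>\<^sub>F q in nhds p.
        (1 + (\<Sum>i=1..m. a i * (cmod (f i q))\<^sup>2)) powr \<alpha>
          = (\<Sum>j=1..n. b j * (cmod (g j q))\<^sup>2)))"
proof
  assume "\<exists>(n::nat) (g :: nat \<Rightarrow> 'a \<Rightarrow> complex) (b :: nat \<Rightarrow> real).
      (\<forall>j\<in>{1..n}. holomorphic_germ A p (g j)) \<and> (\<forall>j\<in>{1..n}. b j \<noteq> 0) \<and>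
      (\<forall>\<^sub>F q in nhds p.
        (1 + (\<Sum>i=1..m. a i * (cmod (f i q))\<^sup>2)) powr \<alpha>
          = (\<Sum>j=1..n. b j * (cmod (g j q))\<^sup>2))"
  then obtain n :: nat and g :: "nat \<Rightarrow> 'a \<Rightarrow> complex" and b :: "nat \<Rightarrow> real"
    where g: "\<And>j. j \<in> {1..n} \<Longrightarrow> holomorphic_germ A p (g j)"
      and eq: "\<forall>\<^sub>F q in nhds p. (1 + (\<Sum>i=1..m. a i * (cmod (f i q))\<^sup>2)) powr \<alpha>
          = (\<Sum>j=1..n. b j * (cmod (g j q))\<^sup>2)"
    by blast
  obtain U \<phi> where C: "C = (U, \<phi>)" by (cases C)
  have ch: "is_cchart (U, \<phi>)" "p \<in> U" and loc: "local_coordinates A p (U, \<phi>)"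
    using assms(3) by (auto simp: C local_coordinates_def)
  have "homeomorphism U (\<phi> ` U) \<phi> (inv_into U \<phi>)" "open U" using ch by (auto simp: is_cchart_def)
  then have inv: "inv_into U \<phi> (\<phi> q) = q" if "q \<in> U" for q
    using that by (auto simp: homeomorphism_def)

  have "\<exists>F. polynomial_several F \<and> (\<forall>\<^sub>F q in nhds p. f i q = F (\<phi> q))" if "i \<in> {1..m}" for i
    using assms(6)[OF that] by (simp add: polynomial_germ_def C)
  then obtain F where F: "\<And>i. i \<in> {1..m} \<Longrightarrow> polynomial_several (F i)"
      "\<And>i. i \<in> {1..m} \<Longrightarrow> \<forall>\<^sub>F q in nhds p. f i q = F i (\<phi> q)" by metis
  have F_near: "\<forall>\<^sub>F q in nhds p. \<forall>i\<in>{1..m}. f i q = F i (\<phi> q)"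
    using F(2) by (intro eventually_ball_finite) auto
  have "\<forall>\<^sub>F q in nhds p. q \<in> U"
    by (rule eventually_nhds_in_open) (use \<open>open U\<close> ch in auto)
  with eq F_near have near: "\<forall>\<^sub>F q in nhds p. q \<in> U \<and>
      (1 + (\<Sum>i=1..m. a i * (cmod (F i (\<phi> q)))\<^sup>2)) powr \<alpha> = (\<Sum>j=1..n. b j * (cmod (g j q))\<^sup>2)"
    by eventually_elim simp
  have "\<forall>\<^sub>F z in nhds (\<phi> p). inv_into U \<phi> z \<in> U \<and>
      (1 + (\<Sum>i=1..m. a i * (cmod (F i (\<phi> (inv_into U \<phi> z))))\<^sup>2)) powr \<alpha>
        = (\<Sum>j=1..n. b j * (cmod (g j (inv_into U \<phi> z)))\<^sup>2)"
    using chart_inverse_tendsto[OF ch] near by (auto simp: filterlim_iff)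
  moreover have "\<forall>\<^sub>F z in nhds (\<phi> p). z \<in> \<phi> ` U"
    by (rule eventually_nhds_in_open) (use ch in \<open>auto simp: is_cchart_def\<close>)
  moreover have "\<forall>\<^sub>F z in nhds (\<phi> p). \<forall>j\<in>{1..n}.
      \<exists>D. ((\<lambda>z. g j (inv_into U \<phi> z)) has_derivative D) (at z) \<and> (\<forall>c v. D (c *s v) = c * D v)"
    using holomorphic_germ_in_local_coordinates[OF _ loc g] assms(1)
    by (intro eventually_ball_finite) (auto simp: complex_manifold_def)
  ultimately have "\<forall>\<^sub>F z in nhds (\<phi> p).
      (1 + (\<Sum>i=1..m. a i * (cmod (F i z))\<^sup>2)) powr \<alpha>
        = (\<Sum>j=1..n. b j * (cmod (g j (inv_into U \<phi> z)))\<^sup>2) \<and> (\<forall>j\<in>{1..n}.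
      \<exists>D. ((\<lambda>z. g j (inv_into U \<phi> z)) has_derivative D) (at z) \<and> (\<forall>c v. D (c *s v) = c * D v))"
    by eventually_elim (simp add: f_inv_into_f)
  then obtain r where r: "r > 0"
      "\<And>z. dist z (\<phi> p) < r \<Longrightarrow> (1 + (\<Sum>i=1..m. a i * (cmod (F i z))\<^sup>2)) powr \<alpha>
        = (\<Sum>j=1..n. b j * (cmod (g j (inv_into U \<phi> z)))\<^sup>2)"
      "\<And>z j. dist z (\<phi> p) < r \<Longrightarrow> j \<in> {1..n} \<Longrightarrow>
        \<exists>D. ((\<lambda>z. g j (inv_into U \<phi> z)) has_derivative D) (at z) \<and> (\<forall>c v. D (c *s v) = c * D v)"
    unfolding eventually_nhds_metric by blast

  have "\<forall>\<^sub>F q in nhds p. dist (\<phi> q) (\<phi> p) < r"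
    using chart_tendsto[OF ch] r(1) by (rule tendstoD)
  with F_near have ev: "\<forall>\<^sub>F q in nhds p. dist (\<phi> q) (\<phi> p) < r \<and> (\<forall>i\<in>{1..m}. f i q = F i (\<phi> q))"
    by eventually_elim simp
  have "\<exists>\<^sub>F q in nhds p. (\<Sum>i=1..m. a i * (cmod (f i q))\<^sup>2) \<noteq> 0"
    using assms(11) by (simp add: zero_hermitian_germ_def frequently_def)
  from frequently_ex[OF frequently_eventually_conj[OF this ev]]
  obtain q where q: "(\<Sum>i=1..m. a i * (cmod (f i q))\<^sup>2) \<noteq> 0" "dist (\<phi> q) (\<phi> p) < r"
      "\<And>i. i \<in> {1..m} \<Longrightarrow> f i q = F i (\<phi> q)"
    by blast

  \<comment> \<open>The line \<open>\<phi> p + t v\<close> meets \<open>\<phi> q\<close>, where the Hermitian form is not zero, at \<open>t = 1\<close>,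
    a boundary point of the disc on which the equation is used; the polynomials extend to it.\<close>
  define v where "v = \<phi> q - \<phi> p"
  have line: "dist (\<phi> p + t *s v) (\<phi> p) < r" if "t \<in> ball 0 1" for t
  proof -
    have "cmod t * norm v \<le> 1 * norm v" using that by (intro mult_right_mono) auto
    also have "\<dots> < r" using q(2) by (simp add: v_def dist_norm)
    finally show ?thesis by (simp add: dist_norm norm_complex_smult)
  qed
  have "\<exists>P. \<forall>t. F i (\<phi> p + t *s v) = poly P t" if "i \<in> {1..m}" for i
    using polynomial_several_on_complex_line[OF F(1)[OF that]] by metis
  then obtain P where P: "\<And>i t. i \<in> {1..m} \<Longrightarrow> F i (\<phi> p + t *s v) = poly (P i) t" by metis
  show False
  proof (rule hermitian_power_not_finite_rank_line[of "{1..m}" "{1..n}" 1 \<alpha> P a 1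
        "\<lambda>j t. g j (inv_into U \<phi> (\<phi> p + t *s v))" b])
    fix i assume i: "i \<in> {1..m}"
    have "f i p = F i (\<phi> p)" using eventually_nhds_x_imp_x[OF F(2)[OF i]] .
    then show "poly (P i) 0 = 0" using P[OF i, of 0] assms(8)[OF i] by simp
  next
    have "poly (P i) 1 = f i q" if "i \<in> {1..m}" for i
      using P[OF that, of 1] q(3)[OF that] by (simp add: v_def)
    then show "(\<Sum>i=1..m. a i * (cmod (poly (P i) 1))\<^sup>2) \<noteq> 0" using q(1) by simp
  next
    fix j assume "j \<in> {1..n}"
    then show "(\<lambda>t. g j (inv_into U \<phi> (\<phi> p + t *s v))) holomorphic_on ball 0 1"
      using r(3) line by (intro holomorphic_on_complex_line) blast
  next
    fix t :: complex assume "t \<in> ball 0 1"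
    from r(2)[OF line[OF this]]
    show "(1 + (\<Sum>i=1..m. a i * (cmod (poly (P i) t))\<^sup>2)) powr \<alpha>
        = (\<Sum>j=1..n. b j * (cmod (g j (inv_into U \<phi> (\<phi> p + t *s v))))\<^sup>2)"
      by (simp add: P)
  qed (use assms(9) in auto)
qed

end
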